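(* Let $\tilde m,d\ge 1$, let $S_{\tilde m d}$ be a constant real skew-symmetric $\tilde m d\times\tilde m d$ matrix, let $H:(\mathbb{R}^d)^{\tilde m}\to\mathbb{R}$, $(\tilde z_1,\dots,\tilde z_{\tilde m})\mapsto H(\tilde z_1,\dots,\tilde z_{\tilde m})$, be sufficiently differentiable, and let $\tau>0$. Consider the partitioned average vector field (PAVF) method for the Hamiltonian system $\dot z=S_{\tilde m d}\nabla H(z)$, $z=(\tilde z_1,\dots,\tilde z_{\tilde m})$: $$ \frac1\tau\,(z^{n+1}-z^n)=S_{\tilde m d}\begin{pmatrix} g_1\\ \vdots\\ g_{\tilde m}\end{pmatrix},\qquad g_k=\int_0^1 H_{\tilde z_k}\big(\tilde z_1^{n+1},\dots,\tilde z_{k-1}^{n+1},\;\xi\tilde z_k^{n+1}+(1-\xi)\tilde z_k^{n},\;\tilde z_{k+1}^{n},\dots,\tilde z_{\tilde m}^{n}\big)\,d\xi\in\mathbb{R}^d, $$ for $k=1,\dots,\tilde m$. Then the method preserves the Hamiltonian exactly: whenever $z^n=(\tilde z_1^n,\dots,\tilde z_{\tilde m}^n)$ and $z^{n+1}=(\tilde z_1^{n+1},\dots,\tilde z_{\tilde m}^{n+1})$ satisfy $$ \frac1\tau\,(z^{n+1}-z^n)=S_{\tilde m d}\begin{pmatrix} g_1\\ \vdots\\ g_{\tilde m}\end{pmatrix} \quad\text{with}\quad g_k=\int_0^1 H_{\tilde z_k}\big(\tilde z_1^{n+1},\dots,\tilde z_{k-1}^{n+1},\;\xi\tilde z_k^{n+1}+(1-\xi)\tilde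 z_k^{n},\;\tilde z_{k+1}^{n},\dots,\tilde z_{\tilde m}^{n}\big)\,d\xi,\quad k=1,\dots,\tilde m, $$ one has $$\frac1\tau\big(H(z^{n+1})-H(z^n)\big)=0 .$$
   Context: $H_{\tilde z_k}$ denotes the gradient (column vector in $\mathbb{R}^d$) of $H$ with respect to its $k$-th block variable $\tilde z_k$. "Sufficiently differentiable" is the paper's standing assumption on $H$; in particular $H$ is continuously differentiable. $\tau$ is the time step. The vector integrals are taken componentwise. *)

theory Defs
  imports "HOL-Analysis.Analysis"
begin

text \<open>
  A point of $(\mathbb{R}^d)^m$ is an element of \<open>real^'d^'m\<close>, with \<open>m = CARD('m)\<close> blocks of
  size \<open>d = CARD('d)\<close>. The linear order on the finite index type \<open>'m\<close> is the order
  \<open>1 < \<dots> < m\<close> of the blocks; it determines which blocks the method has already advanced.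
  The synonym avoids repeating sort constraints.
\<close>

type_synonym ('d, 'm) block_vec = "((real, 'd) vec, 'm) vec"

definition continuously_differentiable :: "('a::real_inner \<Rightarrow> real) \<Rightarrow> bool" where
  "continuously_differentiable f \<longleftrightarrow>
     (\<exists>G. (\<forall>x. GDERIV f x :> G x) \<and> continuous_on UNIV G)"

definition skew_symmetric :: "real^'n^'n \<Rightarrow> bool" where
  "skew_symmetric A \<longleftrightarrow> transpose A = - A"

definition stack :: "('d::finite, 'm::finite) block_vec \<Rightarrow> real^('m \<times> 'd)" where
  "stack z = (\<chi> p. z $ fst p $ snd p)"

definition update_block ::
  "'m \<Rightarrow> real^'d \<Rightarrow> ('d::finite, 'm::finite) block_vec \<Rightarrow> ('d, 'm) block_vec" where
  "update_block k w z = (\<chi> j. if j = k then w else z $ j)"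

text \<open>The gradient of \<open>H\<close> with respect to its \<open>k\<close>-th block variable, at \<open>z\<close>. The description
  is only meaningful where this partial gradient exists, in particular wherever \<open>H\<close> is
  differentiable.\<close>

definition block_gradient ::
  "(('d::finite, 'm::finite) block_vec \<Rightarrow> real) \<Rightarrow> 'm \<Rightarrow> ('d, 'm) block_vec \<Rightarrow> real^'d" where
  "block_gradient H k z = (THE D. GDERIV (\<lambda>w. H (update_block k w z)) (z $ k) :> D)"

definition pavf_point ::
  "('d::finite, 'm::{finite,linorder}) block_vec \<Rightarrow> ('d, 'm) block_vec \<Rightarrow> 'm \<Rightarrow> real \<Rightarrow>
     ('d, 'm) block_vec" where
  "pavf_point z0 z1 k \<xi> =
     (\<chi> j. if j < k then z1 $ j
           else if j = k then \<xi> *\<^sub>R (z1 $ k) + (1 - \<xi>) *\<^sub>R (z0 $ k)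
           else z0 $ j)"

definition pavf_avg_gradient ::
  "(('d::finite, 'm::{finite,linorder}) block_vec \<Rightarrow> real) \<Rightarrow>
     ('d, 'm) block_vec \<Rightarrow> ('d, 'm) block_vec \<Rightarrow> 'm \<Rightarrow> real^'d" where
  "pavf_avg_gradient H z0 z1 k =
     (\<chi> i. integral {0..1} (\<lambda>\<xi>. block_gradient H k (pavf_point z0 z1 k \<xi>) $ i))"

text \<open>One step, of size \<open>\<tau>\<close>, of the partitioned average vector field method for
  $\dot z = S \nabla H(z)$, from \<open>z0\<close> to \<open>z1\<close>. The method is implicit in \<open>z1\<close>,
  so a step is a relation between \<open>z0\<close> and \<open>z1\<close>.\<close>

definition pavf_step ::
  "real^('m::{finite,linorder} \<times> 'd::finite)^('m \<times> 'd) \<Rightarrow>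
     (('d, 'm) block_vec \<Rightarrow> real) \<Rightarrow> real \<Rightarrow> ('d, 'm) block_vec \<Rightarrow> ('d, 'm) block_vec \<Rightarrow> bool" where
  "pavf_step S H \<tau> z0 z1 \<longleftrightarrow>
     (1 / \<tau>) *\<^sub>R stack (z1 - z0) = S *v stack (\<chi> k. pavf_avg_gradient H z0 z1 k)"

end

theory Submission imports Defs begin

text \<open>
  The intermediate points of the method move from \<open>z0\<close> to \<open>z1\<close> one block at a time. Integrating
  the derivative of \<open>H\<close> along the \<open>k\<close>-th leg gives \<open>(z1 $ k - z0 $ k) \<bullet> g\<^sub>k\<close>, and the legs
  telescope, so the averaged gradient \<open>g\<close> is a discrete gradient:
  \<open>(z1 - z0) \<bullet> g = H z1 - H z0\<close>. The step equation turns the left-hand side into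
  \<open>\<tau> * (S g \<bullet> g)\<close>, which is zero because \<open>S\<close> is skew-symmetric.
\<close>

lemma skew_symmetric_inner_self:
  assumes "skew_symmetric A"
  shows "v \<bullet> (A *v v) = 0"
proof -
  have "v \<bullet> (A *v v) = (transpose A *v v) \<bullet> v"
    by (simp add: dot_lmul_matrix)
  also have "transpose A *v v = - (A *v v)"
    using assms by (simp add: skew_symmetric_def vec_eq_iff matrix_vector_mult_def sum_negf)
  finally show ?thesis
    by (simp add: inner_commute)
qed

text \<open>Flattening only reindexes the double sum over blocks and coordinates. This links the
  block-wise gradient identity to the flat coordinates on which \<open>S\<close> acts.\<close>

lemma stack_inner_stack: "stack x \<bullet> stack y = x \<bullet> y"
proof -
  have "stack x \<bullet> stack y = (\<Sum>(j, i)\<in>UNIV \<times> UNIV. x $ j $ i * y $ j $ i)"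
    by (simp add: stack_def inner_vec_def case_prod_beta)
  also have "\<dots> = x \<bullet> y"
    by (simp add: inner_vec_def sum.cartesian_product del: UNIV_Times_UNIV)
  finally show ?thesis .
qed

text \<open>The affine form in direction \<open>axis k\<close> makes the derivative rules
  applicable; \<open>pavf_point\<close> is rewritten likewise below.\<close>

lemma update_block_eq_axis: "update_block k w z = z + axis k (w - z $ k)"
  by (simp add: update_block_def vec_eq_iff axis_def)

lemma pavf_point_eq_axis:
  "pavf_point z0 z1 k \<xi> = pavf_point z0 z1 k 0 + \<xi> *\<^sub>R axis k (z1 $ k - z0 $ k)"
  by (simp add: pavf_point_def vec_eq_iff axis_def algebra_simps)

lemma bounded_linear_axis: "bounded_linear (axis k :: 'a::euclidean_space \<Rightarrow> 'a^'n)"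
  by (intro linear_conv_bounded_linear[THEN iffD1] linearI)
    (simp_all add: axis_def vec_eq_iff)

lemma GDERIV_unique:
  assumes "GDERIV f x :> D" and "GDERIV f x :> E"
  shows "D = E"
proof -
  have "(\<lambda>h. h \<bullet> D) = (\<lambda>h. h \<bullet> E)"
    using assms unfolding gderiv_def by (rule has_derivative_unique)
  \<comment> \<open>Evaluate both functionals at \<open>h = D - E\<close>.\<close>
  then have "(D - E) \<bullet> (D - E) = 0"
    by (metis inner_diff_right cancel_comm_monoid_add_class.diff_cancel)
  then show ?thesis
    by simp
qed

text \<open>By the chain rule the partial derivative is
  \<open>h \<mapsto> axis k h \<bullet> D\<close>, and the adjoint of \<open>axis k\<close> is the
  projection to block \<open>k\<close>. This replaces the description in
  \<open>block_gradient\<close> by a component of the full gradient, which inherits its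
  continuity.\<close>

lemma block_gradient_eq:
  assumes "GDERIV H z :> D"
  shows "block_gradient H k z = D $ k"
proof -
  have "((\<lambda>w. z + axis k (w - z $ k)) has_derivative axis k) (at (z $ k))"
    by (auto intro!: derivative_eq_intros bounded_linear.has_derivative[OF bounded_linear_axis])
  \<comment> \<open>The base point \<open>z\<close> is written as the value of the inner map at
    \<open>z $ k\<close>, as the chain rule expects.\<close>
  moreover have "(H has_derivative (\<lambda>h. h \<bullet> D)) (at (z + axis k (z $ k - z $ k)))"
    using assms by (simp add: gderiv_def linear_0[OF bounded_linear.linear[OF bounded_linear_axis]])
  ultimately have "((\<lambda>w. H (z + axis k (w - z $ k))) has_derivative (\<lambda>h. axis k h \<bullet> D)) (at (z $ k))"
    by (rule has_derivative_compose)
  then have "GDERIV (\<lambda>w. H (update_block k w z)) (z $ k) :> D $ k"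
    by (simp add: gderiv_def update_block_eq_axis inner_axis')
  then show ?thesis
    unfolding block_gradient_def by (blast intro: GDERIV_unique the_equality)
qed

lemma inner_pavf_avg_gradient:
  assumes "continuously_differentiable H"
  shows "(z1 $ k - z0 $ k) \<bullet> pavf_avg_gradient H z0 z1 k
           = H (pavf_point z0 z1 k 1) - H (pavf_point z0 z1 k 0)"
proof -
  let ?p = "pavf_point z0 z1 k" and ?v = "z1 $ k - z0 $ k"
  obtain G where G: "\<And>x. GDERIV H x :> G x" and cont: "continuous_on UNIV G"
    using assms by (auto simp: continuously_differentiable_def)
  have p: "?p = (\<lambda>\<xi>. ?p 0 + \<xi> *\<^sub>R axis k ?v)"
    using pavf_point_eq_axis by blast
  have "continuous_on {0..1} ?p"
    by (subst p) (intro continuous_intros)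
  then have "continuous_on {0..1} (\<lambda>\<xi>. G (?p \<xi>))"
    by (rule continuous_on_compose2[OF cont]) simp
  \<comment> \<open>Integrability of each coordinate justifies exchanging the integral with the
    finite sum in the inner product.\<close>
  then have int: "(\<lambda>\<xi>. G (?p \<xi>) $ k $ i) integrable_on {0..1}" for i
    by (intro integrable_continuous_real continuous_intros)
  have deriv: "((\<lambda>\<xi>. H (?p \<xi>)) has_vector_derivative ?v \<bullet> G (?p \<xi>) $ k) (at \<xi> within {0..1})" for \<xi>
  proof -
    have "(?p has_derivative (\<lambda>t. t *\<^sub>R axis k ?v)) (at \<xi> within {0..1})"
      by (subst p) (auto intro!: derivative_eq_intros)
    moreover have "(H has_derivative (\<lambda>h. h \<bullet> G (?p \<xi>))) (at (?p \<xi>))"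
      using G by (simp add: gderiv_def)
    ultimately have "((\<lambda>\<xi>. H (?p \<xi>)) has_derivative (\<lambda>t. (t *\<^sub>R axis k ?v) \<bullet> G (?p \<xi>)))
        (at \<xi> within {0..1})"
      by (rule has_derivative_compose)
    then show ?thesis
      by (simp add: has_vector_derivative_def inner_axis')
  qed
  have "?v \<bullet> pavf_avg_gradient H z0 z1 k
      = (\<Sum>i\<in>UNIV. integral {0..1} (\<lambda>\<xi>. ?v $ i * G (?p \<xi>) $ k $ i))"
    by (simp add: inner_vec_def[of ?v] pavf_avg_gradient_def block_gradient_eq[OF G])
  also have "\<dots> = integral {0..1} (\<lambda>\<xi>. ?v \<bullet> G (?p \<xi>) $ k)"
    unfolding inner_vec_def[of ?v] inner_real_def
    by (intro integral_sum[symmetric] integrable_on_mult_right int) simp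
  also have "\<dots> = H (?p 1) - H (?p 0)"
    by (intro integral_unique fundamental_theorem_of_calculus deriv) simp
  finally show ?thesis .
qed

lemma sum_pavf_point_telescope:
  fixes z0 z1 :: "('d::finite, 'm::{finite,linorder}) block_vec"
    and H :: "('d, 'm) block_vec \<Rightarrow> real"
  shows "(\<Sum>k\<in>UNIV. H (pavf_point z0 z1 k 1) - H (pavf_point z0 z1 k 0)) = H z1 - H z0"
proof -
  \<comment> \<open>\<open>A\<close> is the set of blocks already advanced. Induction over
    down-closed sets, adding a new maximum each time, replaces induction on a block number.\<close>
  define mix where "mix A = (\<chi> j. if j \<in> A then z1 $ j else z0 $ j)" for A
  have "(\<Sum>k\<in>A. H (pavf_point z0 z1 k 1) - H (pavf_point z0 z1 k 0)) = H (mix A) - H (mix {})"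
    if "finite A" and "\<And>a b. a \<in> A \<Longrightarrow> b \<le> a \<Longrightarrow> b \<in> A" for A :: "'m set"
    using that
  proof (induction A rule: finite_linorder_max_induct)
    case (insert b A)
    \<comment> \<open>Down-closure of \<open>insert b A\<close> forces this, so leg \<open>b\<close>
      starts exactly at \<open>mix A\<close>.\<close>
    have A: "A = {..<b}"
      using insert.hyps(2) insert.prems[of b] by (auto dest: less_imp_le)
    have "pavf_point z0 z1 b 1 = mix (insert b A)" and "pavf_point z0 z1 b 0 = mix A"
      by (auto simp: A pavf_point_def mix_def vec_eq_iff)
    moreover have "(\<Sum>k\<in>A. H (pavf_point z0 z1 k 1) - H (pavf_point z0 z1 k 0))
        = H (mix A) - H (mix {})"
      by (rule insert.IH) (auto simp: A)
    moreover have "b \<notin> A"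
      by (simp add: A)
    ultimately show ?case
      using insert.hyps(1) by simp
  qed simp
  from this[of UNIV] show ?thesis
    by (simp add: mix_def)
qed

theorem theorem2p3:
  fixes S :: "real^('m::{finite,linorder} \<times> 'd::finite)^('m \<times> 'd)"
    and H :: "('d, 'm) block_vec \<Rightarrow> real"
    and \<tau> :: real
    and z0 z1 :: "('d, 'm) block_vec"
  assumes "skew_symmetric S"
    and "continuously_differentiable H"
    and "\<tau> > 0"
    and "pavf_step S H \<tau> z0 z1"
  shows "(1 / \<tau>) * (H z1 - H z0) = 0"
proof -
  define g where "g = (\<chi> k. pavf_avg_gradient H z0 z1 k)"
  have "H z1 - H z0 = (z1 - z0) \<bullet> g"
    by (simp add: inner_vec_def[of "z1 - z0"] g_def inner_pavf_avg_gradient[OF assms(2)]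
        sum_pavf_point_telescope)
  then have "(1 / \<tau>) * (H z1 - H z0) = stack g \<bullet> ((1 / \<tau>) *\<^sub>R stack (z1 - z0))"
    by (simp add: stack_inner_stack inner_commute)
  also have "\<dots> = stack g \<bullet> (S *v stack g)"
    using assms(4) by (simp add: pavf_step_def g_def)
  also have "\<dots> = 0"
    using assms(1) by (rule skew_symmetric_inner_self)
  finally show ?thesis .
qed

end
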